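(* Let $G$ be an abelian group. For any space $\mathfrak{X}$, the cohomology $H^*\bigl(G[\mathrm{CSing}(\mathrm{MinCtl}(\mathfrak{X}))]^*\bigr)$ is the usual singular cohomology of $\mathfrak{X}$ with coefficients in $G$.
   Context: A space is an object of a convenient category $\mathbf{Top}$ of topological spaces (e.g. compactly generated spaces). A controlled set is a set $X$ equipped with a family $\mathcal{U}(X)$ of subsets of $X$ (the controlled subsets) that contains every finite subset of $X$ and is closed under taking subsets and under binary unions. A map $f\colon Y\to X$ of controlled sets is controlled if for every $L\in\mathcal{U}(Y)$ one has $f(L)\in\mathcal{U}(X)$, and $f^{-1}(\{x\})\cap L$ is finite for every $x\in X$. A simplicial controlled set is a simplicial object in the category of controlled sets and controlled maps. A subset $S$ of a controlled set $X$ is cocontrolled if $S\cap T$ is finite for all $T\in\mathcal{U}(X)$. $G[X]^*$ is the abelian group of functions $X\to G$ with cocontrolled support; it is a contravariant functor from controlled sets and controlled maps to abelian groups via pullback of functions. Applying it to a simplicial controlled set $X$ in each degree gives a cosimplicial abelian group $G[X]^*$, and $H^*(G[X]^* )$ denotes the cohomology of the associated cochain complex (with coboundary the alternating sum of coface maps). For a set $S$, $\mathrm{MinCtl}(S)$ is the set $S$ whose controlled subsets are exactly the finite subsets. For a space $\mathfrak{X}$, $\mathrm{CSing}(\mathrm{MinCtl}(\mathfrak{X}))$ is the simplicial controlled set $\mathrm{MinCtl}\circ\mathrm{Sing}(\mathfrak{X})$, i.e. the singular simplicial set $\mathrm{Sing}(\mathfrak{X})$ with controlled set $\mathrm{MinCtl}(\mathrm{Sing}(\mathfrak{X})_n)$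 in degree $n$. *)

theory Defs
  imports "HOL-Homology.Homology"
begin

section \<open>Controlled sets\<close>

record 'a ctl_set =
  points :: "'a set"
  controlled :: "'a set set"

definition controlled_set :: "'a ctl_set \<Rightarrow> bool"
  where "controlled_set X \<longleftrightarrow>
    controlled X \<subseteq> Pow (points X) \<and>
    (\<forall>A. A \<subseteq> points X \<and> finite A \<longrightarrow> A \<in> controlled X) \<and>
    (\<forall>A B. A \<in> controlled X \<and> B \<subseteq> A \<longrightarrow> B \<in> controlled X) \<and>
    (\<forall>A B. A \<in> controlled X \<and> B \<in> controlled X \<longrightarrow> A \<union> B \<in> controlled X)"

definition controlled_map :: "'a ctl_set \<Rightarrow> 'b ctl_set \<Rightarrow> ('a \<Rightarrow> 'b) \<Rightarrow> bool"
  where "controlled_map Y X f \<longleftrightarrow>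
    f \<in> points Y \<rightarrow> points X \<and>
    (\<forall>L \<in> controlled Y. f ` L \<in> controlled X \<and>
       (\<forall>x \<in> points X. finite (f -` {x} \<inter> L)))"

definition cocontrolled :: "'a ctl_set \<Rightarrow> 'a set \<Rightarrow> bool"
  where "cocontrolled X S \<longleftrightarrow> S \<subseteq> points X \<and> (\<forall>T \<in> controlled X. finite (S \<inter> T))"

definition MinCtl :: "'a set \<Rightarrow> 'a ctl_set"
  where "MinCtl S = \<lparr>points = S, controlled = {A. A \<subseteq> S \<and> finite A}\<rparr>"


section \<open>Simplicial controlled sets\<close>

text \<open>The ordinal \<open>[n]\<close> is \<open>{..n}\<close>; its monotone maps are normalised to be extensional, so
  that they form exactly the hom-sets of the simplex category.\<close>

definition Delta_hom :: "nat \<Rightarrow> nat \<Rightarrow> (nat \<Rightarrow> nat) set"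
  where "Delta_hom m n = {\<theta> \<in> {..m} \<rightarrow>\<^sub>E {..n}. mono_on {..m} \<theta>}"

definition Delta_face :: "nat \<Rightarrow> nat \<Rightarrow> nat \<Rightarrow> nat"
  where "Delta_face n i = (\<lambda>j\<in>{..n}. if j < i then j else Suc j)"

text \<open>In a simplicial object, \<open>act X m n \<theta>\<close> is the structure map from degree \<open>n\<close> to degree \<open>m\<close>
  induced by \<open>\<theta> : [m] \<rightarrow> [n]\<close>. The objects \<open>'s\<close> are plain sets \<open>'a set\<close> or controlled
  sets \<open>'a ctl_set\<close>.\<close>

record ('s, 'a) simplicial =
  obj :: "nat \<Rightarrow> 's"
  act :: "nat \<Rightarrow> nat \<Rightarrow> (nat \<Rightarrow> nat) \<Rightarrow> 'a \<Rightarrow> 'a"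

definition simplicial_controlled_set :: "('a ctl_set, 'a) simplicial \<Rightarrow> bool"
  where "simplicial_controlled_set X \<longleftrightarrow>
    (\<forall>n. controlled_set (obj X n)) \<and>
    (\<forall>m n. \<forall>\<theta> \<in> Delta_hom m n. controlled_map (obj X n) (obj X m) (act X m n \<theta>)) \<and>
    (\<forall>n. \<forall>x \<in> points (obj X n). act X n n (\<lambda>j\<in>{..n}. j) x = x) \<and>
    (\<forall>k m n. \<forall>\<eta> \<in> Delta_hom k m. \<forall>\<theta> \<in> Delta_hom m n. \<forall>x \<in> points (obj X n).
       act X k n (compose {..k} \<theta> \<eta>) x = act X k m \<eta> (act X m n \<theta> x))"

definition simplex_operator :: "nat \<Rightarrow> (nat \<Rightarrow> nat) \<Rightarrow> (nat \<Rightarrow> real) \<Rightarrow> nat \<Rightarrow> real"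
  where "simplex_operator m \<theta> t = (\<lambda>j. \<Sum>i | i \<le> m \<and> \<theta> i = j. t i)"

definition Sing :: "'a topology \<Rightarrow> (((nat \<Rightarrow> real) \<Rightarrow> 'a) set, (nat \<Rightarrow> real) \<Rightarrow> 'a) simplicial"
  where "Sing X =
    \<lparr>obj = (\<lambda>n. singular_simplex_set n X),
     act = (\<lambda>m n \<theta> \<sigma>. restrict (\<sigma> \<circ> simplex_operator m \<theta>) (standard_simplex m))\<rparr>"

definition CSing_MinCtl ::
    "'a topology \<Rightarrow> (((nat \<Rightarrow> real) \<Rightarrow> 'a) ctl_set, (nat \<Rightarrow> real) \<Rightarrow> 'a) simplicial"
  where "CSing_MinCtl X = \<lparr>obj = MinCtl \<circ> obj (Sing X), act = act (Sing X)\<rparr>"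


section \<open>Cohomology of a cochain complex\<close>

text \<open>A cochain complex is given by groups \<open>A n\<close> and coboundaries \<open>d n\<close> from \<open>A n\<close> to
  \<open>A (Suc n)\<close>; it vanishes in negative degrees.\<close>

definition cocycles :: "(nat \<Rightarrow> 'c monoid) \<Rightarrow> (nat \<Rightarrow> 'c \<Rightarrow> 'c) \<Rightarrow> nat \<Rightarrow> 'c set"
  where "cocycles A d n = kernel (A n) (A (Suc n)) (d n)"

definition coboundaries :: "(nat \<Rightarrow> 'c monoid) \<Rightarrow> (nat \<Rightarrow> 'c \<Rightarrow> 'c) \<Rightarrow> nat \<Rightarrow> 'c set"
  where "coboundaries A d n =
    (case n of 0 \<Rightarrow> {\<one>\<^bsub>A 0\<^esub>} | Suc m \<Rightarrow> d m ` carrier (A m))"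

definition cohomology_group ::
    "(nat \<Rightarrow> 'c monoid) \<Rightarrow> (nat \<Rightarrow> 'c \<Rightarrow> 'c) \<Rightarrow> nat \<Rightarrow> 'c set monoid"
  where "cohomology_group A d n =
    subgroup_generated (A n) (cocycles A d n) Mod coboundaries A d n"

definition cohomology_class ::
    "(nat \<Rightarrow> 'c monoid) \<Rightarrow> (nat \<Rightarrow> 'c \<Rightarrow> 'c) \<Rightarrow> nat \<Rightarrow> 'c \<Rightarrow> 'c set"
  where "cohomology_class A d n c = coboundaries A d n #>\<^bsub>A n\<^esub> c"


section \<open>The functor \<open>G[-]\<^sup>*\<close>\<close>

text \<open>Coefficient groups are written multiplicatively, as everywhere in \<open>HOL-Algebra\<close>.\<close>

definition ctl_fun_group :: "('g, 'm) monoid_scheme \<Rightarrow> 'a ctl_set \<Rightarrow> ('a \<Rightarrow> 'g) monoid"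
  where "ctl_fun_group G X =
    \<lparr>carrier = {\<phi> \<in> points X \<rightarrow>\<^sub>E carrier G. cocontrolled X {x \<in> points X. \<phi> x \<noteq> \<one>\<^bsub>G\<^esub>}},
     mult = (\<lambda>\<phi> \<psi>. \<lambda>x\<in>points X. \<phi> x \<otimes>\<^bsub>G\<^esub> \<psi> x),
     one = (\<lambda>x\<in>points X. \<one>\<^bsub>G\<^esub>)\<rparr>"

definition ctl_pullback :: "'a ctl_set \<Rightarrow> ('a \<Rightarrow> 'b) \<Rightarrow> ('b \<Rightarrow> 'g) \<Rightarrow> 'a \<Rightarrow> 'g"
  where "ctl_pullback Y f \<phi> = (\<lambda>y\<in>points Y. \<phi> (f y))"

definition ctl_cochain_group ::
    "('g, 'm) monoid_scheme \<Rightarrow> ('a ctl_set, 'a) simplicial \<Rightarrow> nat \<Rightarrow> ('a \<Rightarrow> 'g) monoid"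
  where "ctl_cochain_group G X n = ctl_fun_group G (obj X n)"

definition ctl_coface ::
    "('a ctl_set, 'a) simplicial \<Rightarrow> nat \<Rightarrow> nat \<Rightarrow> ('a \<Rightarrow> 'g) \<Rightarrow> 'a \<Rightarrow> 'g"
  where "ctl_coface X n i = ctl_pullback (obj X (Suc n)) (act X n (Suc n) (Delta_face n i))"

definition ctl_coboundary ::
    "('g, 'm) monoid_scheme \<Rightarrow> ('a ctl_set, 'a) simplicial \<Rightarrow> nat \<Rightarrow> ('a \<Rightarrow> 'g) \<Rightarrow> 'a \<Rightarrow> 'g"
  where "ctl_coboundary G X n \<phi> =
    (\<Otimes>\<^bsub>ctl_cochain_group G X (Suc n)\<^esub> i\<in>{..Suc n}.
       ctl_coface X n i \<phi> [^]\<^bsub>ctl_cochain_group G X (Suc n)\<^esub> ((-1) ^ i :: int))"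


section \<open>Singular cochains with coefficients\<close>

definition singular_cochain_group ::
    "('g, 'm) monoid_scheme \<Rightarrow> 'a topology \<Rightarrow> nat \<Rightarrow> ('a chain \<Rightarrow> 'g) monoid"
  where "singular_cochain_group G X n =
    \<lparr>carrier = hom (chain_group n X) G \<inter> extensional (singular_chain_set n X),
     mult = (\<lambda>c c'. \<lambda>z\<in>singular_chain_set n X. c z \<otimes>\<^bsub>G\<^esub> c' z),
     one = (\<lambda>z\<in>singular_chain_set n X. \<one>\<^bsub>G\<^esub>)\<rparr>"

definition singular_coboundary :: "'a topology \<Rightarrow> nat \<Rightarrow> ('a chain \<Rightarrow> 'g) \<Rightarrow> 'a chain \<Rightarrow> 'g"
  where "singular_coboundary X n c =
    (\<lambda>z\<in>singular_chain_set (Suc n) X. c (chain_boundary (Suc n) z))"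

definition singular_cohomology_group ::
    "('g, 'm) monoid_scheme \<Rightarrow> 'a topology \<Rightarrow> nat \<Rightarrow> ('a chain \<Rightarrow> 'g) set monoid"
  where "singular_cohomology_group G X n =
    cohomology_group (singular_cochain_group G X) (singular_coboundary X) n"


section \<open>Well-definedness\<close>

lemma controlled_set_MinCtl: "controlled_set (MinCtl S)"
  by (auto simp: controlled_set_def MinCtl_def intro: finite_subset)

lemma controlled_map_MinCtl:
  "f \<in> S \<rightarrow> T \<Longrightarrow> controlled_map (MinCtl S) (MinCtl T) f"
  by (auto simp: controlled_map_def MinCtl_def)

lemma simplex_operator_simplex:
  assumes "\<theta> \<in> {..m} \<rightarrow>\<^sub>E {..n}" and t: "t \<in> standard_simplex m"
  shows "simplex_operator m \<theta> t \<in> standard_simplex n"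
proof -
  have t01: "\<And>i. 0 \<le> t i \<and> t i \<le> 1" and ts: "sum t {..m} = 1"
    using t by (auto simp: standard_simplex_def)
  have "(\<Sum>i | i \<le> m \<and> \<theta> i = j. t i) \<le> sum t {..m}" for j
    by (rule sum_mono2) (auto simp: t01)
  moreover have "(\<Sum>i | i \<le> m \<and> \<theta> i = j. t i) = 0" if "n < j" for j
  proof -
    have "{i. i \<le> m \<and> \<theta> i = j} = {}"
      using that assms(1) by (force simp: PiE_iff)
    then show ?thesis by (simp only: sum.empty)
  qed
  moreover have "(\<Sum>j\<le>n. \<Sum>i | i \<le> m \<and> \<theta> i = j. t i) = 1"
    using sum.group [of "{..m}" "{..n}" \<theta> t] assms(1) ts by (auto simp: PiE_iff)
  ultimately show ?thesis
    using ts by (simp add: simplex_operator_def standard_simplex_def t01 sum_nonneg)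
qed

lemma singular_simplex_act:
  assumes "\<theta> \<in> {..m} \<rightarrow>\<^sub>E {..n}" and \<sigma>: "singular_simplex n X \<sigma>"
  shows "singular_simplex m X (restrict (\<sigma> \<circ> simplex_operator m \<theta>) (standard_simplex m))"
proof -
  have "continuous_map (subtopology (powertop_real UNIV) (standard_simplex m))
          (subtopology (powertop_real UNIV) (standard_simplex n)) (simplex_operator m \<theta>)"
    unfolding continuous_map_in_subtopology continuous_map_componentwise_UNIV
  proof (intro conjI allI)
    show "continuous_map (subtopology (powertop_real UNIV) (standard_simplex m)) euclideanreal
            (\<lambda>t. simplex_operator m \<theta> t j)" for j
      unfolding simplex_operator_def
      by (intro continuous_map_sum continuous_map_from_subtopology
            continuous_map_product_projection) auto
  qed (use simplex_operator_simplex [OF assms(1)] in auto)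
  then show ?thesis
    using \<sigma> by (auto simp: singular_simplex_def intro: continuous_map_compose)
qed

lemma simplicial_controlled_set_CSing_MinCtl: "simplicial_controlled_set (CSing_MinCtl X)"
  unfolding simplicial_controlled_set_def
proof (intro conjI allI ballI)
  fix k m n \<eta> \<theta> \<sigma>
  assume \<eta>: "\<eta> \<in> Delta_hom k m" and \<theta>: "\<theta> \<in> Delta_hom m n"
  have "simplex_operator k (compose {..k} \<theta> \<eta>) t = simplex_operator m \<theta> (simplex_operator k \<eta> t)"
    for t
  proof
    fix j
    have eq: "{i. i \<in> {i. i \<le> k \<and> \<theta> (\<eta> i) = j} \<and> \<eta> i = l} = {i. i \<le> k \<and> \<eta> i = l}"
      if "\<theta> l = j" for l
      using that by auto
    have "(\<Sum>i | i \<le> k \<and> \<theta> (\<eta> i) = j. t i)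
        = (\<Sum>l | l \<le> m \<and> \<theta> l = j. \<Sum>i | i \<in> {i. i \<le> k \<and> \<theta> (\<eta> i) = j} \<and> \<eta> i = l. t i)"
      using \<eta> by (intro sum.group [symmetric]) (auto simp: Delta_hom_def PiE_iff)
    also have "\<dots> = (\<Sum>l | l \<le> m \<and> \<theta> l = j. \<Sum>i | i \<le> k \<and> \<eta> i = l. t i)"
      using eq by (intro sum.cong) auto
    finally show "simplex_operator k (compose {..k} \<theta> \<eta>) t j
        = simplex_operator m \<theta> (simplex_operator k \<eta> t) j"
      by (simp add: simplex_operator_def compose_def cong: conj_cong)
  qed
  moreover have "simplex_operator k \<eta> t \<in> standard_simplex m" if "t \<in> standard_simplex k" for t
    using that \<eta> simplex_operator_simplex by (auto simp: Delta_hom_def)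
  ultimately show "act (CSing_MinCtl X) k n (compose {..k} \<theta> \<eta>) \<sigma>
      = act (CSing_MinCtl X) k m \<eta> (act (CSing_MinCtl X) m n \<theta> \<sigma>)"
    by (auto simp: CSing_MinCtl_def Sing_def restrict_def)
next
  fix n \<sigma>
  assume "\<sigma> \<in> points (obj (CSing_MinCtl X) n)"
  then have \<sigma>: "\<sigma> \<in> extensional (standard_simplex n)"
    by (simp add: CSing_MinCtl_def Sing_def MinCtl_def singular_simplex_def)
  have "simplex_operator n (\<lambda>j\<in>{..n}. j) t = t" if "t \<in> standard_simplex n" for t
  proof
    fix j
    have "{i. i \<le> n \<and> (\<lambda>j\<in>{..n}. j) i = j} = (if j \<le> n then {j} else {})"
      by auto
    then show "simplex_operator n (\<lambda>j\<in>{..n}. j) t j = t j"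
      using that by (auto simp: simplex_operator_def standard_simplex_def)
  qed
  then show "act (CSing_MinCtl X) n n (\<lambda>j\<in>{..n}. j) \<sigma> = \<sigma>"
    using \<sigma> by (auto simp: CSing_MinCtl_def Sing_def extensional_def)
qed (auto simp: CSing_MinCtl_def Sing_def Delta_hom_def controlled_set_MinCtl
       intro!: controlled_map_MinCtl singular_simplex_act)

lemma comm_group_ctl_fun_group:
  assumes "comm_group G" and "controlled_set X"
  shows "comm_group (ctl_fun_group G X)"
proof -
  interpret comm_group G by fact
  have closed: "cocontrolled X {x \<in> points X. \<phi> x \<otimes>\<^bsub>G\<^esub> \<psi> x \<noteq> \<one>\<^bsub>G\<^esub>}"
    if "cocontrolled X {x \<in> points X. \<phi> x \<noteq> \<one>\<^bsub>G\<^esub>}" "cocontrolled X {x \<in> points X. \<psi> x \<noteq> \<one>\<^bsub>G\<^esub>}"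
    for \<phi> \<psi>
    unfolding cocontrolled_def
  proof (intro conjI ballI)
    fix T assume T: "T \<in> controlled X"
    have "finite ({x \<in> points X. \<phi> x \<noteq> \<one>\<^bsub>G\<^esub>} \<inter> T \<union> {x \<in> points X. \<psi> x \<noteq> \<one>\<^bsub>G\<^esub>} \<inter> T)"
      using that T by (simp add: cocontrolled_def)
    then show "finite ({x \<in> points X. \<phi> x \<otimes>\<^bsub>G\<^esub> \<psi> x \<noteq> \<one>\<^bsub>G\<^esub>} \<inter> T)"
      by (rule rev_finite_subset) auto
  qed auto
  have inverse: "\<exists>\<psi> \<in> carrier (ctl_fun_group G X).
             (\<lambda>x\<in>points X. \<psi> x \<otimes>\<^bsub>G\<^esub> \<phi> x) = (\<lambda>x\<in>points X. \<one>\<^bsub>G\<^esub>)"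
    if "\<phi> \<in> carrier (ctl_fun_group G X)" for \<phi>
  proof
    have *: "\<phi> x \<in> carrier G" if "x \<in> points X" for x
      using that \<open>\<phi> \<in> _\<close> by (auto simp: ctl_fun_group_def)
    then have "{x \<in> points X. inv\<^bsub>G\<^esub> \<phi> x \<noteq> \<one>\<^bsub>G\<^esub>} = {x \<in> points X. \<phi> x \<noteq> \<one>\<^bsub>G\<^esub>}"
      by (auto simp: inv_eq_1_iff)
    then show "(\<lambda>x\<in>points X. inv\<^bsub>G\<^esub> \<phi> x) \<in> carrier (ctl_fun_group G X)"
      using that * by (auto simp: ctl_fun_group_def cong: conj_cong)
    show "(\<lambda>x\<in>points X. (\<lambda>x\<in>points X. inv\<^bsub>G\<^esub> \<phi> x) x \<otimes>\<^bsub>G\<^esub> \<phi> x) = (\<lambda>x\<in>points X. \<one>\<^bsub>G\<^esub>)"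
      using * by (auto simp: restrict_def)
  qed
  show ?thesis
  proof (rule comm_groupI, goal_cases)
    case (1 \<phi> \<psi>)
    then show ?case
      using closed [of \<phi> \<psi>] by (auto simp: ctl_fun_group_def cong: conj_cong)
  next
    case (3 \<phi> \<psi> \<chi>)
    then show ?case
      by (auto simp: ctl_fun_group_def m_assoc PiE_iff cong: restrict_cong)
  next
    case (6 \<phi>)
    then show ?case using inverse [of \<phi>] by (simp add: ctl_fun_group_def)
  qed (auto simp: ctl_fun_group_def m_comm cocontrolled_def PiE_iff
         cong: conj_cong restrict_cong intro!: extensionalityI)
qed

lemma ctl_pullback_hom:
  assumes f: "controlled_map Y X f"
  shows "ctl_pullback Y f \<in> hom (ctl_fun_group G X) (ctl_fun_group G Y)"
proof -
  have fY: "f y \<in> points X" if "y \<in> points Y" for y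
    using f that by (auto simp: controlled_map_def)
  have "cocontrolled Y {y \<in> points Y. \<phi> (f y) \<noteq> \<one>\<^bsub>G\<^esub>}"
    if "cocontrolled X {x \<in> points X. \<phi> x \<noteq> \<one>\<^bsub>G\<^esub>}" for \<phi>
    unfolding cocontrolled_def
  proof (intro conjI ballI)
    fix L assume L: "L \<in> controlled Y"
    have "finite ({x \<in> points X. \<phi> x \<noteq> \<one>\<^bsub>G\<^esub>} \<inter> f ` L)"
      using that f L by (simp add: cocontrolled_def controlled_map_def)
    then have "finite (\<Union>x \<in> {x \<in> points X. \<phi> x \<noteq> \<one>\<^bsub>G\<^esub>} \<inter> f ` L. f -` {x} \<inter> L)"
      using f L by (intro finite_UN_I) (auto simp: controlled_map_def)
    then show "finite ({y \<in> points Y. \<phi> (f y) \<noteq> \<one>\<^bsub>G\<^esub>} \<inter> L)"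
      by (rule rev_finite_subset) (use fY in auto)
  qed auto
  then show ?thesis
    using fY by (auto simp: hom_def ctl_fun_group_def ctl_pullback_def PiE_iff
        cong: conj_cong intro!: ext)
qed

lemma comm_group_singular_cochain_group:
  assumes "comm_group G"
  shows "comm_group (singular_cochain_group G X n)"
proof -
  interpret comm_group G by fact
  have add: "singular_chain n X (z + w)" if "singular_chain n X z" "singular_chain n X w" for z w
    using that by (rule singular_chain_add)
  have inverse: "\<exists>d \<in> carrier (singular_cochain_group G X n).
        d \<otimes>\<^bsub>singular_cochain_group G X n\<^esub> c = \<one>\<^bsub>singular_cochain_group G X n\<^esub>"
    if "c \<in> carrier (singular_cochain_group G X n)" for c
  proof
    have *: "c z \<in> carrier G" if "singular_chain n X z" for z
      using that \<open>c \<in> _\<close> by (auto simp: singular_cochain_group_def hom_def)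
    then show "(\<lambda>z\<in>singular_chain_set n X. inv\<^bsub>G\<^esub> c z) \<in> carrier (singular_cochain_group G X n)"
      using that by (auto simp: singular_cochain_group_def hom_def add inv_mult)
    show "(\<lambda>z\<in>singular_chain_set n X. inv\<^bsub>G\<^esub> c z) \<otimes>\<^bsub>singular_cochain_group G X n\<^esub> c
        = \<one>\<^bsub>singular_cochain_group G X n\<^esub>"
      using * by (auto simp: singular_cochain_group_def restrict_def)
  qed
  show ?thesis
  proof (rule comm_groupI, goal_cases)
    case (6 c)
    then show ?case by (rule inverse)
  next
    case (5 c)
    then show ?case
      by (auto simp: singular_cochain_group_def hom_def Pi_iff restrict_def extensional_def
          intro!: ext)
  qed (auto simp: singular_cochain_group_def hom_def add Pi_iff m_ac cong: restrict_cong)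
qed

end

theory Submission
  imports Defs
begin

text \<open>Every set of simplices is cocontrolled when only finite sets are controlled, so
  \<open>G[CSing(MinCtl X)]\<^sup>n\<close> consists of all functions from singular \<open>n\<close>-simplices to \<open>G\<close>. As the chain
  group is free on the simplices, restriction to generators identifies these functions with the
  homomorphisms from the chain group to \<open>G\<close>; it commutes with the coboundaries since each cofacial
  pullback is precomposition with a face of the simplex.\<close>

section \<open>Isomorphic cochain complexes\<close>

lemma image_r_coset_hom:
  assumes "f \<in> hom G H" "S \<subseteq> carrier G" "a \<in> carrier G"
  shows "f ` (S #>\<^bsub>G\<^esub> a) = f ` S #>\<^bsub>H\<^esub> f a"
  using assms by (force simp: r_coset_def hom_def image_iff subset_iff)

text \<open>The product in \<open>G Mod S\<close> is the product of subsets, and a homomorphism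
  commutes with products of subsets and with cosets. Hence a bijective homomorphism acts on cosets
  simply by taking images.\<close>

lemma iso_image_FactGroup:
  assumes f: "f \<in> iso G H" and G: "group G" and S: "S \<subseteq> carrier G"
  shows "(`) f \<in> iso (G Mod S) (H Mod (f ` S))"
proof (rule isoI)
  interpret group G by fact
  have hom: "f \<in> hom G H" and bij: "bij_betw f (carrier G) (carrier H)"
    using f by (auto simp: iso_def)
  have coset: "f ` (S #>\<^bsub>G\<^esub> a) = f ` S #>\<^bsub>H\<^esub> f a" if "a \<in> carrier G" for a
    using image_r_coset_hom [OF hom S that] .
  have sub: "T \<subseteq> carrier G" if "T \<in> carrier (G Mod S)" for T
    using that S by (auto simp: FactGroup_def RCOSETS_def dest: r_coset_subset_G [THEN subsetD])
  have image: "(`) f ` carrier (G Mod S) = carrier (H Mod (f ` S))"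
    using coset by (simp add: FactGroup_def RCOSETS_def image_UN flip: bij_betw_imp_surj_on [OF bij])
  show "(`) f \<in> hom (G Mod S) (H Mod (f ` S))"
  proof (rule homI)
    fix T U assume "T \<in> carrier (G Mod S)" "U \<in> carrier (G Mod S)"
    with sub have TU: "T \<subseteq> carrier G" "U \<subseteq> carrier G" by auto
    have "f (h \<otimes>\<^bsub>G\<^esub> k) = f h \<otimes>\<^bsub>H\<^esub> f k" if "h \<in> T" "k \<in> U" for h k
      using that TU by (intro hom_mult [OF hom]) auto
    then show "f ` (T \<otimes>\<^bsub>G Mod S\<^esub> U) = f ` T \<otimes>\<^bsub>H Mod (f ` S)\<^esub> f ` U"
      by (simp add: FactGroup_def set_mult_def image_UN)
  qed (use image in blast)
  \<comment> \<open>Taking images under an injective map is injective on all subsets of the carrier,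
    in particular on cosets.\<close>
  have "inj_on ((`) f) (carrier (G Mod S))"
    by (rule inj_on_subset [OF inj_on_image_Pow [OF bij_betw_imp_inj_on [OF bij]]]) (use sub in auto)
  with image show "bij_betw ((`) f) (carrier (G Mod S)) (carrier (H Mod (f ` S)))"
    by (simp add: bij_betw_def)
qed

text \<open>Generating a subgroup commutes with homomorphic images. This carries the group of
  cocycles, which \<open>cohomology_group\<close> forms by \<open>subgroup_generated\<close>, across
  an isomorphism.\<close>

lemma iso_subgroup_generated_image:
  assumes f: "f \<in> iso G H" and "group G" "group H" and S: "S \<subseteq> carrier G"
  shows "f \<in> iso (subgroup_generated G S) (subgroup_generated H (f ` S))"
proof -
  interpret group_hom G H f
    using assms by (simp add: group_hom_def group_hom_axioms_def iso_def)
  have inj: "inj_on f (carrier G)" and "f ` S \<subseteq> carrier H"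
    using f S by (auto simp: iso_def bij_betw_def)
  \<comment> \<open>\<open>subgroup_generated\<close> first intersects its generators with the
    carrier; as \<open>S\<close> and its image lie in the carriers, nothing is lost.\<close>
  then have img: "f ` carrier (subgroup_generated G S) = carrier (subgroup_generated H (f ` S))"
    using generate_img [OF S] S by (simp add: carrier_subgroup_generated Int_absorb1)
  have sub: "carrier (subgroup_generated G S) \<subseteq> carrier G"
    by (rule G.carrier_subgroup_generated_subset)
  show ?thesis
  proof (rule isoI)
    show "f \<in> hom (subgroup_generated G S) (subgroup_generated H (f ` S))"
      using img sub homh by (intro homI) (auto simp: hom_def subset_iff)
    show "bij_betw f (carrier (subgroup_generated G S)) (carrier (subgroup_generated H (f ` S)))"
      using img inj_on_subset [OF inj sub] by (simp add: bij_betw_def)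
  qed
qed

text \<open>A degreewise isomorphism commuting with coboundaries matches kernels with kernels and
  images with images. On carriers \<open>e\<close> is the conjugate of \<open>d\<close> by
  \<open>f\<close>, so the hypotheses on \<open>d\<close> also control \<open>e\<close>. The second
  conclusion identifies the induced map on classes.\<close>

lemma cohomology_group_iso:
  assumes A: "\<And>n. group (A n)" and B: "\<And>n. group (B n)"
    and f: "\<And>n. f n \<in> iso (A n) (B n)"
    and d: "\<And>n x. x \<in> carrier (A n) \<Longrightarrow> d n x \<in> carrier (A (Suc n))"
    and dd: "\<And>n x. x \<in> carrier (A n) \<Longrightarrow> d (Suc n) (d n x) = \<one>\<^bsub>A (Suc (Suc n))\<^esub>"
    and d_one: "d 0 \<one>\<^bsub>A 0\<^esub> = \<one>\<^bsub>A (Suc 0)\<^esub>"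
    and comm: "\<And>n x. x \<in> carrier (A n) \<Longrightarrow> e n (f n x) = f (Suc n) (d n x)"
  shows "(`) (f n) \<in> iso (cohomology_group A d n) (cohomology_group B e n)"
    and "c \<in> cocycles A d n \<Longrightarrow>
      f n ` cohomology_class A d n c = cohomology_class B e n (f n c)"
proof -
  have hom: "f n \<in> hom (A n) (B n)" and bij: "bij_betw (f n) (carrier (A n)) (carrier (B n))" for n
    using f [of n] by (auto simp: iso_def)
  have one: "f n \<one>\<^bsub>A n\<^esub> = \<one>\<^bsub>B n\<^esub>" for n
    using hom_one [OF hom A B] .
  \<comment> \<open>Injectivity makes \<open>f\<close> reflect the identity, so that cocycles
    correspond in both directions.\<close>
  have one_iff: "f n x = \<one>\<^bsub>B n\<^esub> \<longleftrightarrow> x = \<one>\<^bsub>A n\<^esub>" if "x \<in> carrier (A n)" for n x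
    using that one [of n] bij_betw_imp_inj_on [OF bij, of n] A [of n]
    by (metis group.is_monoid inj_onD monoid.one_closed)
  have surj: "f n ` carrier (A n) = carrier (B n)" for n
    using bij_betw_imp_surj_on [OF bij] .
  have Z: "f n ` cocycles A d n = cocycles B e n"
  proof -
    have "x \<in> cocycles A d n \<longleftrightarrow> f n x \<in> cocycles B e n" if "x \<in> carrier (A n)" for x
      using that surj [of n] one_iff [OF d] comm by (auto simp: cocycles_def kernel_def)
    moreover have "cocycles A d n \<subseteq> carrier (A n)" "cocycles B e n \<subseteq> f n ` carrier (A n)"
      by (auto simp: cocycles_def kernel_def surj)
    ultimately show ?thesis by blast
  qed
  have Bd: "f n ` coboundaries A d n = coboundaries B e n"
  proof (cases n)
    case (Suc m)
    have "f (Suc m) ` d m ` carrier (A m) = e m ` f m ` carrier (A m)"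
      using comm by (simp add: image_image)
    then show ?thesis by (simp add: Suc coboundaries_def surj)
  qed (simp add: coboundaries_def one)
  \<comment> \<open>In positive degrees the inclusion is \<open>dd\<close>; in degree 0 the only
    coboundary is the identity, and \<open>d_one\<close> applies.\<close>
  have sub: "coboundaries A d n \<subseteq> cocycles A d n"
    using d dd d_one A [THEN group.is_monoid, THEN monoid.one_closed]
    by (auto simp: coboundaries_def cocycles_def kernel_def split: nat.split)
  have Zsub: "cocycles A d n \<subseteq> carrier (A n)"
    by (auto simp: cocycles_def kernel_def)
  interpret group "A n" by (rule A)
  have "f n \<in> iso (subgroup_generated (A n) (cocycles A d n))
      (subgroup_generated (B n) (cocycles B e n))"
    using iso_subgroup_generated_image [OF f A B Zsub] Z by simp
  moreover have "coboundaries A d n \<subseteq> carrier (subgroup_generated (A n) (cocycles A d n))"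
    using sub subgroup_generated_subset_carrier_subset [OF Zsub] by blast
  ultimately show "(`) (f n) \<in> iso (cohomology_group A d n) (cohomology_group B e n)"
    unfolding cohomology_group_def Bd [symmetric]
    by (intro iso_image_FactGroup) auto
  show "f n ` cohomology_class A d n c = cohomology_class B e n (f n c)"
    if "c \<in> cocycles A d n"
    unfolding cohomology_class_def Bd [symmetric]
    by (rule image_r_coset_hom [OF hom]) (use that sub Zsub in auto)
qed


section \<open>Cochains on the free generators\<close>

lemma hom_finprod_comm_group:
  assumes "comm_group G" "comm_group H" and h: "h \<in> hom G H" and f: "f \<in> A \<rightarrow> carrier G"
  shows "h (finprod G f A) = finprod H (\<lambda>x. h (f x)) A"
proof -
  interpret G: comm_group G by fact
  interpret H: comm_group H by fact
  \<comment> \<open>This settles empty and infinite index sets, where \<open>finprod\<close> is the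
    identity.\<close>
  have h1: "h \<one>\<^bsub>G\<^esub> = \<one>\<^bsub>H\<^esub>"
    using hom_one [OF h] by simp
  show ?thesis
    using f
  proof (induction A rule: infinite_finite_induct)
    case (insert x F)
    then have "f x \<in> carrier G" "f \<in> F \<rightarrow> carrier G" by auto
    moreover from this have "(\<lambda>x. h (f x)) \<in> F \<rightarrow> carrier H" "h (f x) \<in> carrier H"
      using hom_in_carrier [OF h] by auto
    ultimately show ?case
      using insert h by (simp add: hom_mult)
  qed (auto simp: h1)
qed

text \<open>The bridge between the additive notation of \<open>chain_boundary\<close> and the
  multiplicative notation in which homomorphisms into \<open>G\<close> are stated.\<close>

lemma finprod_free_Abelian_group:
  assumes "finite A" "f \<in> A \<rightarrow> carrier (free_Abelian_group S)"
  shows "finprod (free_Abelian_group S) f A = sum f A"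
proof -
  interpret comm_group "free_Abelian_group S" by (rule abelian_free_Abelian_group)
  show ?thesis
    using assms by (induction A) (auto simp: Pi_iff)
qed

text \<open>The boundary of a simplex is a product, in the free abelian group, of its faces raised
  to the powers 1 and -1; a homomorphism passes through the product and the powers.\<close>

lemma hom_chain_boundary_frag_of:
  assumes "comm_group G" and c: "c \<in> hom (chain_group n X) G"
    and \<sigma>: "singular_simplex (Suc n) X \<sigma>"
  shows "c (chain_boundary (Suc n) (frag_of \<sigma>))
    = (\<Otimes>\<^bsub>G\<^esub> i\<in>{..Suc n}. c (frag_of (singular_face (Suc n) i \<sigma>)) [^]\<^bsub>G\<^esub> ((-1) ^ i :: int))"
proof -
  interpret comm_group G by fact
  let ?F = "free_Abelian_group (singular_simplex_set n X)"
  have hom: "c \<in> hom ?F G"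
    using c by (simp add: chain_group_def)
  have face: "singular_simplex n X (singular_face (Suc n) i \<sigma>)" if "i \<le> Suc n" for i
    using singular_simplex_singular_face [OF \<sigma>, of i] that by simp
  \<comment> \<open>Signs become integer powers, the form in which they occur in
    \<open>ctl_coboundary\<close>.\<close>
  have cmul: "frag_cmul ((-1) ^ i) (frag_of (singular_face (Suc n) i \<sigma>))
      = frag_of (singular_face (Suc n) i \<sigma>) [^]\<^bsub>?F\<^esub> ((-1) ^ i :: int)" if "i \<le> Suc n" for i
    using face [OF that] by simp
  have mem: "frag_of (singular_face (Suc n) i \<sigma>) \<in> carrier ?F" if "i \<le> Suc n" for i
    using face [OF that] by simp
  have closed: "(\<lambda>i. frag_of (singular_face (Suc n) i \<sigma>) [^]\<^bsub>?F\<^esub> ((-1) ^ i :: int))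
      \<in> {..Suc n} \<rightarrow> carrier ?F"
    using mem group.int_pow_closed [OF group_free_Abelian_group] by blast
  \<comment> \<open>In degree \<open>Suc n\<close> the convention that boundaries of 0-chains vanish
    does not interfere.\<close>
  have "chain_boundary (Suc n) (frag_of \<sigma>)
      = (\<Sum>i\<le>Suc n. frag_of (singular_face (Suc n) i \<sigma>) [^]\<^bsub>?F\<^esub> ((-1) ^ i :: int))"
    unfolding chain_boundary_of by (simp only: nat.distinct if_False) (auto simp only: atMost_iff cmul intro!: sum.cong)
  also have "\<dots> = finprod ?F (\<lambda>i. frag_of (singular_face (Suc n) i \<sigma>) [^]\<^bsub>?F\<^esub> ((-1) ^ i :: int)) {..Suc n}"
    using closed by (intro finprod_free_Abelian_group [symmetric]) auto
  finally have "c (chain_boundary (Suc n) (frag_of \<sigma>))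
      = finprod G (\<lambda>i. c (frag_of (singular_face (Suc n) i \<sigma>) [^]\<^bsub>?F\<^esub> ((-1) ^ i :: int))) {..Suc n}"
    using hom_finprod_comm_group [OF abelian_free_Abelian_group assms(1) hom closed] by simp
  also have "\<dots> = (\<Otimes>\<^bsub>G\<^esub> i\<in>{..Suc n}. c (frag_of (singular_face (Suc n) i \<sigma>)) [^]\<^bsub>G\<^esub> ((-1) ^ i :: int))"
  proof (rule finprod_cong')
    show "(\<lambda>i. c (frag_of (singular_face (Suc n) i \<sigma>)) [^]\<^bsub>G\<^esub> ((-1) ^ i :: int)) \<in> {..Suc n} \<rightarrow> carrier G"
      using mem hom_in_carrier [OF hom] by auto
    show "c (frag_of (singular_face (Suc n) i \<sigma>) [^]\<^bsub>?F\<^esub> ((-1) ^ i :: int))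
        = c (frag_of (singular_face (Suc n) i \<sigma>)) [^]\<^bsub>G\<^esub> ((-1) ^ i :: int)"
      if "i \<in> {..Suc n}" for i
      using hom_int_pow [OF hom mem group_free_Abelian_group is_group] that by blast
  qed simp
  finally show ?thesis .
qed

section \<open>Cofaces and coboundary of the controlled cochains\<close>

lemma singular_face_eq_act:
  assumes "i \<le> Suc n"
  shows "act (Sing X) n (Suc n) (Delta_face n i) = singular_face (Suc n) i"
proof
  fix \<sigma>
  have "simplex_operator n (Delta_face n i) t = simplical_face i t" if t: "t \<in> standard_simplex n" for t
  proof
    fix j
    \<comment> \<open>Coordinate \<open>j\<close> of the image point is the sum of \<open>t\<close>
      over this fibre. The empty fibre over \<open>i\<close> inserts the zero coordinate, and larger
      indices are shifted by one. Above \<open>Suc n\<close> the fibres are empty too, in agreement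
      with \<open>t\<close> vanishing above \<open>n\<close>.\<close>
    have "{k. k \<le> n \<and> Delta_face n i k = j}
        = (if j < i then {j} else if j = i \<or> Suc n < j then {} else {j - 1})"
      using assms by (auto simp: Delta_face_def split: if_splits)
    then show "simplex_operator n (Delta_face n i) t j = simplical_face i t j"
      using t by (auto simp: simplex_operator_def simplical_face_def standard_simplex_def)
  qed
  then show "act (Sing X) n (Suc n) (Delta_face n i) \<sigma> = singular_face (Suc n) i \<sigma>"
    by (auto simp: Sing_def singular_face_def restrict_def)
qed

text \<open>Controlled subsets are finite here, so every support meets them in finite sets and the
  support condition holds automatically.\<close>

lemma carrier_ctl_cochain_group_CSing_MinCtl:
  "carrier (ctl_cochain_group G (CSing_MinCtl X) n) = singular_simplex_set n X \<rightarrow>\<^sub>E carrier G"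
  by (auto simp: ctl_cochain_group_def ctl_fun_group_def CSing_MinCtl_def MinCtl_def Sing_def
      cocontrolled_def)

lemma points_CSing_MinCtl: "points (obj (CSing_MinCtl X) n) = singular_simplex_set n X"
  by (simp add: CSing_MinCtl_def MinCtl_def Sing_def)

lemma comm_group_ctl_cochain_group_CSing_MinCtl:
  assumes "comm_group G"
  shows "comm_group (ctl_cochain_group G (CSing_MinCtl X) n)"
  using assms simplicial_controlled_set_CSing_MinCtl [of X]
  by (simp add: ctl_cochain_group_def comm_group_ctl_fun_group simplicial_controlled_set_def)

text \<open>The product and the powers defining the coboundary live in a group of functions.
  Evaluation at a simplex is a homomorphism to \<open>G\<close>, so both can be computed
  pointwise.\<close>

lemma ctl_coboundary_CSing_MinCtl:
  assumes "comm_group G" and \<phi>: "\<phi> \<in> singular_simplex_set n X \<rightarrow>\<^sub>E carrier G"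
  shows "ctl_coboundary G (CSing_MinCtl X) n \<phi>
    = (\<lambda>\<sigma>\<in>singular_simplex_set (Suc n) X.
        \<Otimes>\<^bsub>G\<^esub> i\<in>{..Suc n}. \<phi> (singular_face (Suc n) i \<sigma>) [^]\<^bsub>G\<^esub> ((-1) ^ i :: int))"
proof -
  interpret G: comm_group G by fact
  let ?C = "ctl_cochain_group G (CSing_MinCtl X) (Suc n)"
  interpret C: comm_group ?C
    by (rule comm_group_ctl_cochain_group_CSing_MinCtl) fact
  have coface: "ctl_coface (CSing_MinCtl X) n i \<phi>
      = (\<lambda>\<sigma>\<in>singular_simplex_set (Suc n) X. \<phi> (singular_face (Suc n) i \<sigma>))" if "i \<le> Suc n" for i
    using singular_face_eq_act [OF that, of X] points_CSing_MinCtl [of X "Suc n"]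
    by (simp add: ctl_coface_def ctl_pullback_def) (simp add: CSing_MinCtl_def)
  have face: "singular_simplex n X (singular_face (Suc n) i \<sigma>)"
    if "i \<le> Suc n" "singular_simplex (Suc n) X \<sigma>" for i \<sigma>
    using singular_simplex_singular_face [OF that(2), of i] that(1) by simp
  have mem: "ctl_coface (CSing_MinCtl X) n i \<phi> \<in> carrier ?C" if "i \<le> Suc n" for i
    unfolding coface [OF that] carrier_ctl_cochain_group_CSing_MinCtl
    using face [OF that] \<phi> by auto
  have closed: "(\<lambda>i. ctl_coface (CSing_MinCtl X) n i \<phi> [^]\<^bsub>?C\<^esub> ((-1) ^ i :: int))
      \<in> {..Suc n} \<rightarrow> carrier ?C"
    using mem by auto
  show ?thesis
  proof (rule extensionalityI)
    \<comment> \<open>The product stays in the carrier, whose members are extensional.\<close>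
    show "ctl_coboundary G (CSing_MinCtl X) n \<phi> \<in> extensional (singular_simplex_set (Suc n) X)"
      using C.finprod_closed [OF closed]
      by (simp add: ctl_coboundary_def carrier_ctl_cochain_group_CSing_MinCtl PiE_iff)
  next
    fix \<sigma> assume \<sigma>: "\<sigma> \<in> singular_simplex_set (Suc n) X"
    then have eval: "(\<lambda>\<psi>. \<psi> \<sigma>) \<in> hom ?C G"
      by (intro homI) (auto simp: carrier_ctl_cochain_group_CSing_MinCtl ctl_cochain_group_def
          ctl_fun_group_def points_CSing_MinCtl)
    have pow: "(ctl_coface (CSing_MinCtl X) n i \<phi> [^]\<^bsub>?C\<^esub> ((-1) ^ i :: int)) \<sigma>
        = \<phi> (singular_face (Suc n) i \<sigma>) [^]\<^bsub>G\<^esub> ((-1) ^ i :: int)" if "i \<le> Suc n" for i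
      using hom_int_pow [OF eval mem [OF that] C.group_axioms G.group_axioms] \<sigma> coface [OF that]
      by simp
    have "ctl_coboundary G (CSing_MinCtl X) n \<phi> \<sigma>
        = (\<Otimes>\<^bsub>G\<^esub> i\<in>{..Suc n}. (ctl_coface (CSing_MinCtl X) n i \<phi> [^]\<^bsub>?C\<^esub> ((-1) ^ i :: int)) \<sigma>)"
      unfolding ctl_coboundary_def
      by (rule hom_finprod_comm_group [OF C.comm_group_axioms G.comm_group_axioms eval closed])
    also have "\<dots> = (\<Otimes>\<^bsub>G\<^esub> i\<in>{..Suc n}. \<phi> (singular_face (Suc n) i \<sigma>) [^]\<^bsub>G\<^esub> ((-1) ^ i :: int))"
      by (rule G.finprod_cong') (use pow face \<phi> \<sigma> in auto)
    finally show "ctl_coboundary G (CSing_MinCtl X) n \<phi> \<sigma>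
      = (\<lambda>\<sigma>\<in>singular_simplex_set (Suc n) X.
          \<Otimes>\<^bsub>G\<^esub> i\<in>{..Suc n}. \<phi> (singular_face (Suc n) i \<sigma>) [^]\<^bsub>G\<^esub> ((-1) ^ i :: int)) \<sigma>"
      using \<sigma> by simp
  qed simp
qed

section \<open>Restriction of cochains to the free generators\<close>

lemma hom_free_Abelian_group_eqI:
  assumes "group G" and c: "c \<in> hom (free_Abelian_group S) G" and c': "c' \<in> hom (free_Abelian_group S) G"
    and eq: "\<And>x. x \<in> S \<Longrightarrow> c (frag_of x) = c' (frag_of x)" and z: "Poly_Mapping.keys z \<subseteq> S"
  shows "c z = c' z"
proof -
  interpret c: group_hom "free_Abelian_group S" G c
    using assms by (simp add: group_hom_def group_hom_axioms_def)
  interpret c': group_hom "free_Abelian_group S" G c'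
    using assms by (simp add: group_hom_def group_hom_axioms_def)
  show ?thesis
  \<comment> \<open>Chains arise from generators by differences, so agreement spreads from
    generators once a difference is read as a product with an inverse.\<close>
  proof (rule free_Abelian_group_induct [where P = "\<lambda>z. c z = c' z", OF z])
    show "c 0 = c' 0" using c.hom_one c'.hom_one by simp
  next
    fix x y assume xy: "Poly_Mapping.keys x \<subseteq> S" "Poly_Mapping.keys y \<subseteq> S" "c x = c' x" "c y = c' y"
    then have mem: "x \<in> carrier (free_Abelian_group S)"
        "y \<in> carrier (free_Abelian_group S)" "inv\<^bsub>free_Abelian_group S\<^esub> y \<in> carrier (free_Abelian_group S)"
      by auto
    have diff: "x - y = x \<otimes>\<^bsub>free_Abelian_group S\<^esub> inv\<^bsub>free_Abelian_group S\<^esub> y"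
      using xy by simp
    show "c (x - y) = c' (x - y)"
      unfolding diff c.hom_mult [OF mem(1,3)] c'.hom_mult [OF mem(1,3)]
        c.hom_inv [OF mem(2)] c'.hom_inv [OF mem(2)] xy(3,4) ..
  qed (rule eq)
qed

text \<open>This is the universal property of the free abelian group: uniqueness of extensions gives
  injectivity, existence gives surjectivity. Both sides multiply pointwise.\<close>

lemma iso_singular_ctl_cochain_group:
  assumes "comm_group G"
  shows "(\<lambda>c. \<lambda>\<sigma>\<in>singular_simplex_set n X. c (frag_of \<sigma>))
    \<in> iso (singular_cochain_group G X n) (ctl_cochain_group G (CSing_MinCtl X) n)"
    (is "?f \<in> iso ?A ?B")
proof (rule isoI)
  interpret comm_group G by fact
  have carrier: "c \<in> carrier ?A \<longleftrightarrow>
      c \<in> hom (free_Abelian_group (singular_simplex_set n X)) G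
      \<and> c \<in> extensional (singular_chain_set n X)" for c
    by (simp add: singular_cochain_group_def chain_group_def)
  have maps: "?f c \<in> carrier ?B" if "c \<in> carrier ?A" for c
    using that unfolding carrier carrier_ctl_cochain_group_CSing_MinCtl
    by (auto intro: hom_in_carrier)
  show "?f \<in> hom ?A ?B"
  proof (rule homI)
    fix c c' assume "c \<in> carrier ?A" "c' \<in> carrier ?A"
    show "?f (c \<otimes>\<^bsub>?A\<^esub> c') = ?f c \<otimes>\<^bsub>?B\<^esub> ?f c'"
      by (auto simp: singular_cochain_group_def ctl_cochain_group_def ctl_fun_group_def
          points_CSing_MinCtl singular_chain_of cong: restrict_cong)
  qed (rule maps)
  show "bij_betw ?f (carrier ?A) (carrier ?B)"
  proof (rule bij_betw_imageI)
    show "inj_on ?f (carrier ?A)"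
    proof (rule inj_onI)
      fix c c' assume c: "c \<in> carrier ?A" and c': "c' \<in> carrier ?A" and eq: "?f c = ?f c'"
      have "c (frag_of \<sigma>) = c' (frag_of \<sigma>)" if "\<sigma> \<in> singular_simplex_set n X" for \<sigma>
        using fun_cong [OF eq, of \<sigma>] that by simp
      then have "c z = c' z" if "singular_chain n X z" for z
        using c c' that hom_free_Abelian_group_eqI [OF is_group, of c _ c' z]
        unfolding carrier singular_chain_def by blast
      then show "c = c'"
        using c c' unfolding carrier by (intro extensionalityI) auto
    qed
    have "\<phi> \<in> ?f ` carrier ?A" if \<phi>: "\<phi> \<in> carrier ?B" for \<phi>
    proof -
      have "\<phi> ` singular_simplex_set n X \<subseteq> carrier G"
        using \<phi> by (auto simp: carrier_ctl_cochain_group_CSing_MinCtl)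
      then obtain h where h: "h \<in> hom (free_Abelian_group (singular_simplex_set n X)) G"
        and h\<phi>: "\<And>\<sigma>. \<sigma> \<in> singular_simplex_set n X \<Longrightarrow> h (frag_of \<sigma>) = \<phi> \<sigma>"
        using free_Abelian_group_universal by blast
      \<comment> \<open>The universal property leaves \<open>h\<close> unspecified off the chains,
        whereas cochains must be extensional.\<close>
      let ?c = "restrict h (singular_chain_set n X)"
      have "?c \<in> carrier ?A"
        using h by (auto simp: singular_cochain_group_def hom_def singular_chain_add chain_group_def
            simp flip: singular_chain_def)
      moreover have "?f ?c = \<phi>"
        using \<phi> h\<phi> by (intro extensionalityI [of _ "singular_simplex_set n X"])
          (auto simp: carrier_ctl_cochain_group_CSing_MinCtl singular_chain_of PiE_iff)
      ultimately show ?thesis by blast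
    qed
    then show "?f ` carrier ?A = carrier ?B"
      using maps by blast
  qed
qed

section \<open>The singular cochain complex and compatibility of the coboundaries\<close>

lemma singular_coboundary_closed:
  assumes "c \<in> carrier (singular_cochain_group G X n)"
  shows "singular_coboundary X n c \<in> carrier (singular_cochain_group G X (Suc n))"
  using assms
  by (auto simp: singular_cochain_group_def singular_coboundary_def hom_def Pi_iff
      singular_chain_boundary_alt singular_chain_add chain_boundary_add)

lemma cochain_zero:
  assumes "group G" "c \<in> carrier (singular_cochain_group G X n)"
  shows "c 0 = \<one>\<^bsub>G\<^esub>"
  using hom_one [of c "chain_group n X" G] assms
  by (simp add: singular_cochain_group_def chain_group_def)

text \<open>The double boundary of a chain is zero, and a cochain sends the zero chain to the
  identity.\<close>

lemma singular_coboundary_coboundary: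
  assumes "group G" "c \<in> carrier (singular_cochain_group G X n)"
  shows "singular_coboundary X (Suc n) (singular_coboundary X n c)
    = \<one>\<^bsub>singular_cochain_group G X (Suc (Suc n))\<^esub>"
  using cochain_zero [OF assms]
  by (auto simp: singular_coboundary_def singular_cochain_group_def singular_chain_boundary_alt
      chain_boundary_boundary_alt cong: restrict_cong)

text \<open>Used in degree 0, where the identity is the only coboundary and has to be a
  cocycle.\<close>

lemma singular_coboundary_one:
  "singular_coboundary X n \<one>\<^bsub>singular_cochain_group G X n\<^esub>
    = \<one>\<^bsub>singular_cochain_group G X (Suc n)\<^esub>"
  by (auto simp: singular_coboundary_def singular_cochain_group_def singular_chain_boundary_alt
      cong: restrict_cong)

text \<open>Restriction to generators is a cochain map: on each simplex both sides are the
  alternating product of the values of \<open>c\<close> on the faces.\<close>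

lemma ctl_coboundary_restrict_cochain:
  assumes "comm_group G" and c: "c \<in> carrier (singular_cochain_group G X n)"
  shows "ctl_coboundary G (CSing_MinCtl X) n (\<lambda>\<sigma>\<in>singular_simplex_set n X. c (frag_of \<sigma>))
    = (\<lambda>\<sigma>\<in>singular_simplex_set (Suc n) X. singular_coboundary X n c (frag_of \<sigma>))"
proof -
  interpret comm_group G by fact
  have hom: "c \<in> hom (chain_group n X) G"
    using c by (simp add: singular_cochain_group_def)
  have closed: "c (frag_of \<sigma>) \<in> carrier G" if "singular_simplex n X \<sigma>" for \<sigma>
    using hom_in_carrier [OF hom] that by (simp add: singular_chain_of)
  have face: "singular_simplex n X (singular_face (Suc n) i \<sigma>)"
    if "i \<le> Suc n" "singular_simplex (Suc n) X \<sigma>" for i \<sigma>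
    using singular_simplex_singular_face [OF that(2), of i] that(1) by simp
  have mem: "(\<lambda>\<sigma>\<in>singular_simplex_set n X. c (frag_of \<sigma>)) \<in> singular_simplex_set n X \<rightarrow>\<^sub>E carrier G"
    using closed by auto
  show ?thesis
    unfolding ctl_coboundary_CSing_MinCtl [OF assms(1) mem]
  proof (rule restrict_ext)
    fix \<sigma> assume \<sigma>: "\<sigma> \<in> singular_simplex_set (Suc n) X"
    have "(\<Otimes>\<^bsub>G\<^esub> i\<in>{..Suc n}. (\<lambda>\<sigma>\<in>singular_simplex_set n X. c (frag_of \<sigma>))
          (singular_face (Suc n) i \<sigma>) [^]\<^bsub>G\<^esub> ((-1) ^ i :: int))
        = (\<Otimes>\<^bsub>G\<^esub> i\<in>{..Suc n}. c (frag_of (singular_face (Suc n) i \<sigma>)) [^]\<^bsub>G\<^esub> ((-1) ^ i :: int))"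
      by (rule finprod_cong') (use face closed \<sigma> in auto)
    also have "\<dots> = c (chain_boundary (Suc n) (frag_of \<sigma>))"
      using hom_chain_boundary_frag_of [OF assms(1) hom] \<sigma> by simp
    also have "\<dots> = singular_coboundary X n c (frag_of \<sigma>)"
      using \<sigma> by (simp add: singular_coboundary_def singular_chain_of)
    finally show "(\<Otimes>\<^bsub>G\<^esub> i\<in>{..Suc n}. (\<lambda>\<sigma>\<in>singular_simplex_set n X. c (frag_of \<sigma>))
          (singular_face (Suc n) i \<sigma>) [^]\<^bsub>G\<^esub> ((-1) ^ i :: int))
        = singular_coboundary X n c (frag_of \<sigma>)" .
  qed
qed

text \<open>The clause on cocycles says that the isomorphism is induced by restricting cochains to
  simplices, so it is the natural comparison and not just some isomorphism.\<close>

theorem proposition5p4: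
  fixes G :: "('g, 'm) monoid_scheme" and X :: "'a topology"
  assumes "comm_group G"
  shows "\<forall>n. \<exists>\<Phi> \<in> iso (singular_cohomology_group G X n)
                   (cohomology_group (ctl_cochain_group G (CSing_MinCtl X))
                      (ctl_coboundary G (CSing_MinCtl X)) n).
           \<forall>c \<in> cocycles (singular_cochain_group G X) (singular_coboundary X) n.
             \<Phi> (cohomology_class (singular_cochain_group G X) (singular_coboundary X) n c)
             = cohomology_class (ctl_cochain_group G (CSing_MinCtl X))
                 (ctl_coboundary G (CSing_MinCtl X)) n
                 (\<lambda>\<sigma>\<in>singular_simplex_set n X. c (frag_of \<sigma>))"
proof
  fix n
  interpret comm_group G by fact
  define f :: "nat \<Rightarrow> ('a chain \<Rightarrow> 'g) \<Rightarrow> ((nat \<Rightarrow> real) \<Rightarrow> 'a) \<Rightarrow> 'g"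
    where "f n c = (\<lambda>\<sigma>\<in>singular_simplex_set n X. c (frag_of \<sigma>))" for n c
  have f: "f n \<in> iso (singular_cochain_group G X n) (ctl_cochain_group G (CSing_MinCtl X) n)" for n
    using iso_singular_ctl_cochain_group [OF assms, of n X] by (simp add: f_def [abs_def])
  have comm: "ctl_coboundary G (CSing_MinCtl X) n (f n c) = f (Suc n) (singular_coboundary X n c)"
    if "c \<in> carrier (singular_cochain_group G X n)" for n c
    unfolding f_def using ctl_coboundary_restrict_cochain [OF assms that] .
  have A: "group (singular_cochain_group G X n)" for n
    by (rule comm_group.axioms(2) [OF comm_group_singular_cochain_group [OF assms]])
  have B: "group (ctl_cochain_group G (CSing_MinCtl X) n)" for n
    by (rule comm_group.axioms(2) [OF comm_group_ctl_cochain_group_CSing_MinCtl [OF assms]])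
  note iso = cohomology_group_iso [where f = f, OF A B f singular_coboundary_closed
      singular_coboundary_coboundary [OF is_group] singular_coboundary_one comm]
  show "\<exists>\<Phi> \<in> iso (singular_cohomology_group G X n)
                   (cohomology_group (ctl_cochain_group G (CSing_MinCtl X))
                      (ctl_coboundary G (CSing_MinCtl X)) n).
           \<forall>c \<in> cocycles (singular_cochain_group G X) (singular_coboundary X) n.
             \<Phi> (cohomology_class (singular_cochain_group G X) (singular_coboundary X) n c)
             = cohomology_class (ctl_cochain_group G (CSing_MinCtl X))
                 (ctl_coboundary G (CSing_MinCtl X)) n
                 (\<lambda>\<sigma>\<in>singular_simplex_set n X. c (frag_of \<sigma>))"
    unfolding singular_cohomology_group_def f_def [symmetric]
    \<comment> \<open>The witness sends a coset of cochains to its image under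
      \<open>f n\<close>.\<close>
    by (rule bexI [OF _ iso(1)]) (use iso(2) in blast)
qed

end
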